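(* Let $(X,\mathfrak{B})$ and $r\colon X\to X$ be as in the context. Let $V\colon X\to[0,\infty)$ be a bounded $\mathfrak{B}$-measurable map. For a measure $\mu_0$ on $(X,\mathfrak{B})$, the following assertions are equivalent. (i) The measure $\mu_0$ has the fixed-point property $$\int_XV\,f\circ r\,d\mu_0=\int_Xf\,d\mu_0\qquad\text{for all }f\in L^\infty(X,\mu_0).$$ (ii) There exists a non-negative, $\mathfrak{B}$-measurable map $\Delta$ on $X$ (depending on $V$ and $\mu_0$) such that $$\sum_{r(y)=x}\Delta(y)=1\qquad\text{for }\mu_0\text{-a.e. }x\in X,$$ and $$\int_XV\,f\,d\mu_0=\int_X\sum_{r(y)=x}\Delta(y)f(y)\,d\mu_0(x)\qquad\text{for all }f\in L^\infty(X,\mu_0).$$ Moreover, when the assertions are true, $\Delta$ is unique up to $V\,d\mu_0$-measure zero.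
   Context: $X$ is a non-empty set, $\mathfrak{B}$ a $\sigma$-algebra of subsets of $X$, and $r\colon X\to X$ an onto, finite-to-one, $\mathfrak{B}$-measurable map. The inverse branches of $r$ can be labelled measurably: $\mathfrak{c}(x)=\#\,r^{-1}(x)$ is measurable, and with $A_i=\{x\in X\mid\mathfrak{c}(x)\ge i\}$, $i\in\mathbb{N}$, there are measurable maps $\tau_i\colon A_i\to X$ with $r^{-1}(x)=\{\tau_1(x),\dots,\tau_{\mathfrak{c}(x)}(x)\}$ (a list without repetitions) for all $x\in X$, and $\tau_i(A_i)\in\mathfrak{B}$ for all $i$. Measures are positive and finite. *)

theory Defs
  imports "HOL-Analysis.Analysis"
begin

definition fibre :: "'a measure \<Rightarrow> ('a \<Rightarrow> 'a) \<Rightarrow> 'a \<Rightarrow> 'a set" where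
  "fibre M r x = r -` {x} \<inter> space M"

definition level_set :: "'a measure \<Rightarrow> ('a \<Rightarrow> 'a) \<Rightarrow> nat \<Rightarrow> 'a set" where
  "level_set M r i = {x \<in> space M. i \<le> card (fibre M r x)}"

text \<open>
  Only the underlying measurable space of \<open>M\<close> matters in the next two definitions; the
  branches are numbered from 1.
\<close>

definition measurable_branches :: "'a measure \<Rightarrow> ('a \<Rightarrow> 'a) \<Rightarrow> (nat \<Rightarrow> 'a \<Rightarrow> 'a) \<Rightarrow> bool" where
  "measurable_branches M r \<tau> \<longleftrightarrow>
     (\<lambda>x. card (fibre M r x)) \<in> measurable M (count_space UNIV) \<and>
     (\<forall>i\<ge>1. \<tau> i \<in> measurable (restrict_space M (level_set M r i)) M) \<and>
     (\<forall>x\<in>space M. bij_betw (\<lambda>i. \<tau> i x) {1..card (fibre M r x)} (fibre M r x)) \<and>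
     (\<forall>i\<ge>1. \<tau> i ` level_set M r i \<in> sets M)"

definition branched_endomorphism :: "'a measure \<Rightarrow> ('a \<Rightarrow> 'a) \<Rightarrow> bool" where
  "branched_endomorphism M r \<longleftrightarrow>
     r \<in> measurable M M \<and>
     r ` space M = space M \<and>
     (\<forall>x\<in>space M. finite (fibre M r x)) \<and>
     (\<exists>\<tau>. measurable_branches M r \<tau>)"

text \<open>
  The representatives of the elements of complex \<open>L\<^sup>\<infinity>\<close>: essentially bounded measurable
  functions, not identified modulo null sets.
\<close>

definition L_infinity :: "'a measure \<Rightarrow> ('a \<Rightarrow> complex) set" where
  "L_infinity M = {f \<in> borel_measurable M. \<exists>C. AE x in M. cmod (f x) \<le> C}"

text \<open>
  A representative \<open>f\<close> may be unbounded on a null set, and then \<open>f \<circ> r\<close> need not be essentially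
  bounded a priori. The existence of the integrals is therefore part of the two properties
  below, since the library integral of a non-integrable function is 0.
\<close>

definition fixed_point_property :: "'a measure \<Rightarrow> ('a \<Rightarrow> 'a) \<Rightarrow> ('a \<Rightarrow> real) \<Rightarrow> bool" where
  "fixed_point_property M r V \<longleftrightarrow>
     (\<forall>f\<in>L_infinity M.
        integrable M (\<lambda>x. complex_of_real (V x) * (f \<circ> r) x) \<and>
        (\<integral>x. complex_of_real (V x) * (f \<circ> r) x \<partial>M) = (\<integral>x. f x \<partial>M))"

definition transition_weight ::
    "'a measure \<Rightarrow> ('a \<Rightarrow> 'a) \<Rightarrow> ('a \<Rightarrow> real) \<Rightarrow> ('a \<Rightarrow> real) \<Rightarrow> bool" where
  "transition_weight M r V \<Delta> \<longleftrightarrow>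
     \<Delta> \<in> borel_measurable M \<and>
     (\<forall>x\<in>space M. 0 \<le> \<Delta> x) \<and>
     (AE x in M. (\<Sum>y\<in>fibre M r x. \<Delta> y) = 1) \<and>
     (\<forall>f\<in>L_infinity M.
        integrable M (\<lambda>x. \<Sum>y\<in>fibre M r x. complex_of_real (\<Delta> y) * f y) \<and>
        (\<integral>x. complex_of_real (V x) * f x \<partial>M) =
          (\<integral>x. (\<Sum>y\<in>fibre M r x. complex_of_real (\<Delta> y) * f y) \<partial>M))"

end

theory Submission
  imports Defs
begin

text \<open>
  Let \<open>\<lambda>(B) = \<integral> #(r\<^sup>-\<^sup>1(x) \<inter> B) d\<mu>\<^sub>0(x)\<close>. The branches of \<open>r\<close> show that \<open>\<lambda>\<close> is \<open>\<sigma>\<close>-finite, and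
  \<open>\<integral> g d\<lambda> = \<integral> \<Sum>\<^bsub>r(y)=x\<^esub> g(y) d\<mu>\<^sub>0(x)\<close>. Hence (ii) says that \<open>\<Delta>\<close> is a density of \<open>V d\<mu>\<^sub>0\<close> with
  respect to \<open>\<lambda>\<close> whose fibre sums are 1 almost everywhere, and (i) says that the image of
  \<open>V d\<mu>\<^sub>0\<close> under \<open>r\<close> is \<open>\<mu>\<^sub>0\<close>. The image of \<open>\<Delta> d\<lambda>\<close> under \<open>r\<close> has the fibre sum of \<open>\<Delta>\<close> as its
  density with respect to \<open>\<mu>\<^sub>0\<close>, so the two conditions match as soon as a density exists.
  Under (i) it does, by Radon-Nikodym: if \<open>\<lambda>(B) = 0\<close> then \<open>r(B)\<close> is \<open>\<mu>\<^sub>0\<close>-null, and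
  \<open>B \<subseteq> r\<^sup>-\<^sup>1(r(B))\<close>. Uniqueness is the uniqueness of densities.
\<close>

section \<open>Fibre sums, and the measure \<lambda> that they define\<close>

locale branched_measure = finite_measure M for M :: "'a measure" +
  fixes r :: "'a \<Rightarrow> 'a"
  assumes branched: "branched_endomorphism M r"
begin

text \<open>The value type is left general because sums are taken in \<open>ennreal\<close>, in
  \<open>real\<close> and in \<open>complex\<close>.\<close>

definition fibre_sum :: "('a \<Rightarrow> 'b::comm_monoid_add) \<Rightarrow> 'a \<Rightarrow> 'b" where
  "fibre_sum g x = (\<Sum>y\<in>fibre M r x. g y)"

text \<open>The \<lambda> of the overview: for \<open>x\<close> in \<open>space M\<close> the
  integrand counts the points of \<open>B\<close> in the fibre over \<open>x\<close>.
  \<open>measure_of\<close> falls back to the zero measure when the set function is not a measure;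
  \<open>emeasure_fibre_measure\<close> rules this out.\<close>

definition fibre_measure :: "'a measure" where
  "fibre_measure =
     measure_of (space M) (sets M) (\<lambda>B. \<integral>\<^sup>+x. fibre_sum (indicator B) x \<partial>M)"

lemma measurable_r [measurable]: "r \<in> measurable M M"
  using branched by (simp add: branched_endomorphism_def)

lemma finite_fibre: "x \<in> space M \<Longrightarrow> finite (fibre M r x)"
  using branched by (simp add: branched_endomorphism_def)

lemma mem_fibre: "y \<in> fibre M r x \<longleftrightarrow> y \<in> space M \<and> r y = x"
  by (auto simp: fibre_def)

lemma r_space: "x \<in> space M \<Longrightarrow> r x \<in> space M"
  using measurable_space[OF measurable_r] .

text \<open>The branches turn the sum over a fibre into a sum over the indices from 1 to the size of
  the fibre. For a fixed number of terms this sum is measurable, and the number of terms is a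
  measurable function with countably many values.\<close>

lemma borel_measurable_fibre_sum [measurable (raw)]:
  fixes g :: "'a \<Rightarrow> 'b::{second_countable_topology, topological_comm_monoid_add}"
  assumes g [measurable]: "g \<in> borel_measurable M"
  shows "fibre_sum g \<in> borel_measurable M"
proof -
  obtain \<tau> where \<tau>: "measurable_branches M r \<tau>"
    using branched by (auto simp: branched_endomorphism_def)
  have card [measurable]: "(\<lambda>x. card (fibre M r x)) \<in> measurable M (count_space UNIV)"
    using \<tau> by (simp add: measurable_branches_def)
  have level [measurable]: "level_set M r i \<in> sets M" for i
    unfolding level_set_def by measurable
  \<comment> \<open>\<open>\<tau> i\<close> is measurable only on its level set, so the term is
    extended by 0 outside; for the indices that occur at \<open>x\<close> the guard is true.\<close>
  have term_meas: "(\<lambda>x. if x \<in> level_set M r i then g (\<tau> i x) else 0) \<in> borel_measurable M"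
    if "i \<in> {1..n}" for i n
  proof -
    have "{x \<in> space M. x \<in> level_set M r i} \<in> sets M"
      by measurable
    moreover have "\<tau> i \<in> measurable (restrict_space M (level_set M r i)) M"
      using \<tau> that by (auto simp: measurable_branches_def)
    ultimately show ?thesis
      by (subst measurable_If_restrict_space_iff) (auto intro: measurable_compose[OF _ g])
  qed
  have sum_meas: "(\<lambda>x. \<Sum>i=1..n. if x \<in> level_set M r i then g (\<tau> i x) else 0)
      \<in> borel_measurable M" for n
    using term_meas by (rule borel_measurable_sum)
  have "(\<lambda>x. \<Sum>i=1..card (fibre M r x). if x \<in> level_set M r i then g (\<tau> i x) else 0)
      \<in> borel_measurable M"
    by (rule measurable_compose_countable[OF sum_meas card])
  moreover have "fibre_sum g x =
      (\<Sum>i=1..card (fibre M r x). if x \<in> level_set M r i then g (\<tau> i x) else 0)"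
    if x: "x \<in> space M" for x
  proof -
    have bij: "bij_betw (\<lambda>i. \<tau> i x) {1..card (fibre M r x)} (fibre M r x)"
      using \<tau> x by (auto simp: measurable_branches_def)
    show ?thesis
      unfolding fibre_sum_def sum.reindex_bij_betw[OF bij, symmetric]
      by (rule sum.cong) (auto simp: level_set_def x)
  qed
  ultimately show ?thesis
    by (simp cong: measurable_cong)
qed

lemma space_fibre_measure [simp]: "space fibre_measure = space M"
  and sets_fibre_measure [simp, measurable_cong]: "sets fibre_measure = sets M"
  by (simp_all add: fibre_measure_def)

text \<open>The content is countable additivity: the sum over the pieces \<open>A i\<close> passes
  through the integral, by monotone convergence, and through the fibre sum.\<close>

lemma emeasure_fibre_measure:
  assumes "B \<in> sets M"
  shows "emeasure fibre_measure B = (\<integral>\<^sup>+x. fibre_sum (indicator B) x \<partial>M)"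
  using fibre_measure_def
proof (rule emeasure_measure_of)
  show "sets M \<subseteq> Pow (space M)"
    by (rule sets.space_closed)
  show "B \<in> sets fibre_measure"
    using assms by simp
  show "positive (sets fibre_measure) (\<lambda>B. \<integral>\<^sup>+x. fibre_sum (indicator B) x \<partial>M)"
    by (simp add: positive_def fibre_sum_def)
  show "countably_additive (sets fibre_measure) (\<lambda>B. \<integral>\<^sup>+x. fibre_sum (indicator B) x \<partial>M)"
  proof (rule countably_additiveI)
    fix A :: "nat \<Rightarrow> 'a set"
    assume "range A \<subseteq> sets fibre_measure" and disj: "disjoint_family A"
    then have [measurable]: "A i \<in> sets M" for i
      by auto
    have "(\<Sum>i. \<integral>\<^sup>+x. fibre_sum (indicator (A i)) x \<partial>M)
        = (\<integral>\<^sup>+x. (\<Sum>i. fibre_sum (indicator (A i)) x) \<partial>M)"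
      by (rule nn_integral_suminf[symmetric]) measurable
    also have "\<dots> = (\<integral>\<^sup>+x. fibre_sum (indicator (\<Union>i. A i)) x \<partial>M)"
      by (simp add: fibre_sum_def suminf_sum suminf_indicator[OF disj])
    finally show "(\<Sum>i. \<integral>\<^sup>+x. fibre_sum (indicator (A i)) x \<partial>M)
        = (\<integral>\<^sup>+x. fibre_sum (indicator (\<Union>i. A i)) x \<partial>M)" .
  qed
qed

text \<open>For indicators this is the definition of \<lambda>. Fibre sums commute with scalar
  multiples, sums and increasing limits, so the identity extends to all measurable
  functions.\<close>

lemma nn_integral_fibre_measure:
  assumes "g \<in> borel_measurable M"
  shows "(\<integral>\<^sup>+x. g x \<partial>fibre_measure) = (\<integral>\<^sup>+x. fibre_sum g x \<partial>M)"
  using assms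
proof (induction g rule: borel_measurable_induct)
  case (cong f g)
  \<comment> \<open>The functions agree only on \<open>space M\<close>, but this contains every
    fibre.\<close>
  have "fibre_sum f x = fibre_sum g x" for x
    unfolding fibre_sum_def by (rule sum.cong) (auto simp: mem_fibre cong)
  then have eq: "fibre_sum f = fibre_sum g"
    by auto
  have "(\<integral>\<^sup>+x. f x \<partial>fibre_measure) = (\<integral>\<^sup>+x. g x \<partial>fibre_measure)"
    by (rule nn_integral_cong) (simp add: cong)
  then show ?case
    using cong eq by simp
next
  case (set A)
  then show ?case
    by (simp add: emeasure_fibre_measure)
next
  case (mult u c)
  have "fibre_sum (\<lambda>x. c * u x) x = c * fibre_sum u x" for x
    by (simp add: fibre_sum_def sum_distrib_left)
  with mult show ?case
    by (simp add: nn_integral_cmult borel_measurable_fibre_sum)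
next
  case (add u v)
  have "fibre_sum (\<lambda>x. v x + u x) x = fibre_sum v x + fibre_sum u x" for x
    by (simp add: fibre_sum_def sum.distrib)
  with add show ?case
    by (simp add: nn_integral_add borel_measurable_fibre_sum)
next
  case (seq U)
  have mono: "incseq (\<lambda>i. U i x)" for x
    using \<open>incseq U\<close> by (auto simp: incseq_def le_fun_def)
  have inc: "incseq (\<lambda>i. fibre_sum (U i))"
    using \<open>incseq U\<close>
    by (auto simp: incseq_def le_fun_def fibre_sum_def intro!: sum_mono)
  have "(\<integral>\<^sup>+x. (SUP i. U i) x \<partial>fibre_measure) = (SUP i. \<integral>\<^sup>+x. U i x \<partial>fibre_measure)"
    unfolding SUP_apply using seq by (intro nn_integral_monotone_convergence_SUP) auto
  also have "\<dots> = (SUP i. \<integral>\<^sup>+x. fibre_sum (U i) x \<partial>M)"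
    using seq by simp
  also have "\<dots> = (\<integral>\<^sup>+x. (SUP i. fibre_sum (U i) x) \<partial>M)"
    using seq inc
    by (intro nn_integral_monotone_convergence_SUP[symmetric] borel_measurable_fibre_sum)
  also have "\<dots> = (\<integral>\<^sup>+x. fibre_sum (SUP i. U i) x \<partial>M)"
    unfolding fibre_sum_def SUP_apply
    by (simp add: image_comp ennreal_SUP_sum[OF mono])
  finally show ?case .
qed

text \<open>The images \<open>T i\<close> of the branches cover \<open>space M\<close>, and the
  fibre over \<open>x\<close> meets \<open>T i\<close> at most in \<open>\<tau> i x\<close>. Hence
  the \<lambda>-measure of \<open>T i\<close> is at most the total mass of \<open>M\<close>.\<close>

lemma sigma_finite_fibre_measure: "sigma_finite_measure fibre_measure"
proof
  obtain \<tau> where \<tau>: "measurable_branches M r \<tau>"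
    using branched by (auto simp: branched_endomorphism_def)
  define T where "T i = \<tau> i ` level_set M r i" for i
  have sets_T: "T i \<in> sets M" if "i \<ge> 1" for i
    using \<tau> that by (auto simp: T_def measurable_branches_def)
  have bij: "bij_betw (\<lambda>i. \<tau> i x) {1..card (fibre M r x)} (fibre M r x)" if "x \<in> space M" for x
    using \<tau> that by (auto simp: measurable_branches_def)
  have branch: "r (\<tau> i x) = x" if "i \<ge> 1" "x \<in> level_set M r i" for i x
    using bij_betwE[OF bij, of x] that by (auto simp: level_set_def mem_fibre)
  have cover: "(\<Union>i\<in>{1..}. T i) = space M"
  proof
    show "(\<Union>i\<in>{1..}. T i) \<subseteq> space M"
      using sets_T[THEN sets.sets_into_space] by auto
    show "space M \<subseteq> (\<Union>i\<in>{1..}. T i)"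
    proof
      fix y assume y: "y \<in> space M"
      then have "y \<in> (\<lambda>i. \<tau> i (r y)) ` {1..card (fibre M r (r y))}"
        using bij_betw_imp_surj_on[OF bij[OF r_space[OF y]]] by (simp add: mem_fibre)
      then obtain i where "i \<in> {1..card (fibre M r (r y))}" "y = \<tau> i (r y)"
        by auto
      with y show "y \<in> (\<Union>i\<in>{1..}. T i)"
        by (auto simp: T_def level_set_def r_space intro!: bexI[of _ i])
    qed
  qed
  have fin: "emeasure fibre_measure (T i) \<noteq> \<infinity>" if i: "i \<ge> 1" for i
  proof -
    have le: "fibre_sum (indicator (T i)) x \<le> (1::ennreal)" if x: "x \<in> space M" for x
    proof -
      \<comment> \<open>If \<open>\<tau> i z\<close> with \<open>z\<close> in the level set lies
        over \<open>x\<close>, then \<open>z = x\<close>, since \<open>r\<close> undoes the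
        branch.\<close>
      have "fibre M r x \<inter> T i \<subseteq> {\<tau> i x}"
        using branch[OF i] by (auto simp: mem_fibre T_def)
      then have "card (fibre M r x \<inter> T i) \<le> card {\<tau> i x}"
        by (rule card_mono[rotated]) simp
      then have "of_nat (card (fibre M r x \<inter> T i)) \<le> (of_nat 1 :: ennreal)"
        by (subst of_nat_le_iff) simp
      moreover have "fibre_sum (indicator (T i)) x = (of_nat (card (fibre M r x \<inter> T i)) :: ennreal)"
        unfolding fibre_sum_def by (simp add: indicator_def sum.If_cases finite_fibre[OF x])
      ultimately show ?thesis
        by simp
    qed
    have "emeasure fibre_measure (T i) \<le> (\<integral>\<^sup>+x. 1 \<partial>M)"
      unfolding emeasure_fibre_measure[OF sets_T[OF i]] using le by (rule nn_integral_mono)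
    also have "\<dots> < \<infinity>"
      by (simp add: emeasure_finite less_top[symmetric])
    finally show ?thesis
      by simp
  qed
  show "\<exists>A. countable A \<and> A \<subseteq> sets fibre_measure \<and> \<Union> A = space fibre_measure \<and>
      (\<forall>a\<in>A. emeasure fibre_measure a \<noteq> \<infinity>)"
    using sets_T cover fin by (intro exI[of _ "T ` {1..}"]) auto
qed

text \<open>The Bochner counterpart of \<open>nn_integral_fibre_measure\<close>, needed for the
  complex integrands in (ii). The last step of the induction is dominated convergence on both
  sides.\<close>

lemma integral_fibre_measure:
  fixes f :: "'a \<Rightarrow> 'b::{banach, second_countable_topology}"
  assumes "integrable fibre_measure f"
  shows "integrable M (fibre_sum f) \<and> (\<integral>x. fibre_sum f x \<partial>M) = (\<integral>x. f x \<partial>fibre_measure)"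
  using assms
proof (induction f rule: integrable_induct)
  case (base A c)
  then have A [measurable]: "A \<in> sets M" by simp
  \<comment> \<open>The integral defining \<lambda> is taken in \<open>ennreal\<close>; the fibre
    sum of the real indicator is compared with it here.\<close>
  have nn: "(\<integral>\<^sup>+x. ennreal (fibre_sum (indicator A) x) \<partial>M) = emeasure fibre_measure A"
    unfolding emeasure_fibre_measure[OF A] fibre_sum_def
    by (intro nn_integral_cong) (simp add: sum_ennreal[symmetric] ennreal_indicator)
  have pos: "0 \<le> (fibre_sum (indicator A) x :: real)" for x
    by (simp add: fibre_sum_def sum_nonneg)
  have int: "integrable M (fibre_sum (indicator A) :: 'a \<Rightarrow> real)"
    using nn base pos by (intro integrableI_nonneg) auto
  have "(\<integral>x. fibre_sum (indicator A) x \<partial>M) = measure fibre_measure A"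
    using pos by (subst integral_eq_nn_integral) (auto simp: nn measure_def)
  moreover have "fibre_sum (\<lambda>x. indicator A x *\<^sub>R c) = (\<lambda>x. fibre_sum (indicator A) x *\<^sub>R c)"
    by (simp add: fibre_sum_def fun_eq_iff scaleR_sum_left)
  ultimately show ?case
    using int base by simp
next
  case (add f g)
  have "fibre_sum (\<lambda>x. f x + g x) = (\<lambda>x. fibre_sum f x + fibre_sum g x)"
    by (simp add: fibre_sum_def sum.distrib fun_eq_iff)
  then show ?case
    using add by simp
next
  case (lim f s)
  have [measurable]: "f \<in> borel_measurable M"
    using borel_measurable_integrable[OF lim.hyps(4)] by simp
  have [measurable]: "s i \<in> borel_measurable M" for i
    using borel_measurable_integrable[OF lim.hyps(1)[of i]] by simp
  \<comment> \<open>The approximants satisfy \<open>norm (s i x) \<le> 2 * norm (f x)\<close>, so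
    \<open>w\<close> dominates their fibre sums. It is integrable because its integral over
    \<open>M\<close> is that of \<open>2 * norm (f x)\<close> over \<lambda>.\<close>
  define w where "w = fibre_sum (\<lambda>x. 2 * norm (f x))"
  have w: "integrable M w"
  proof (rule integrableI_nonneg)
    show "w \<in> borel_measurable M"
      unfolding w_def by measurable
    show "AE x in M. 0 \<le> w x"
      by (simp add: w_def fibre_sum_def sum_nonneg)
    have "(\<integral>\<^sup>+x. ennreal (w x) \<partial>M) = (\<integral>\<^sup>+x. fibre_sum (\<lambda>x. ennreal (2 * norm (f x))) x \<partial>M)"
      by (simp add: w_def fibre_sum_def sum_ennreal)
    also have "\<dots> = (\<integral>\<^sup>+x. ennreal (2 * norm (f x)) \<partial>fibre_measure)"
      by (rule nn_integral_fibre_measure[symmetric]) measurable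
    also have "\<dots> < \<infinity>"
      using lim.hyps(4) integrable_iff_bounded[of fibre_measure "\<lambda>x. 2 * norm (f x)"] by simp
    finally show "(\<integral>\<^sup>+x. ennreal (w x) \<partial>M) < \<infinity>" .
  qed
  have bound: "AE x in M. norm (fibre_sum (s i) x) \<le> w x" for i
    unfolding w_def fibre_sum_def using lim.hyps(3)
    by (intro AE_I2 sum_norm_le) (auto simp: mem_fibre)
  have conv: "AE x in M. (\<lambda>i. fibre_sum (s i) x) \<longlonglongrightarrow> fibre_sum f x"
    unfolding fibre_sum_def using lim.hyps(2) by (intro AE_I2 tendsto_sum) (auto simp: mem_fibre)
  have "integrable M (fibre_sum f)"
    using w conv bound by (rule integrable_dominated_convergence[rotated 2]) measurable
  moreover have "(\<lambda>i. \<integral>x. fibre_sum (s i) x \<partial>M) \<longlonglongrightarrow> (\<integral>x. fibre_sum f x \<partial>M)"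
    using w conv bound by (rule integral_dominated_convergence[rotated 2]) measurable
  moreover have "(\<lambda>i. \<integral>x. s i x \<partial>fibre_measure) \<longlonglongrightarrow> (\<integral>x. f x \<partial>fibre_measure)"
    using lim.hyps
    by (intro integral_dominated_convergence[where w="\<lambda>x. 2 * norm (f x)"]) auto
  moreover have "(\<integral>x. fibre_sum (s i) x \<partial>M) = (\<integral>x. s i x \<partial>fibre_measure)" for i
    using lim.IH by simp
  ultimately show ?case
    using LIMSEQ_unique by auto
qed

section \<open>Images under \<open>r\<close> and absolute continuity\<close>

lemma distr_density_fibre_measure:
  assumes [measurable]: "g \<in> borel_measurable M"
  shows "distr (density fibre_measure g) M r = density M (fibre_sum g)"
proof (rule measure_eqI)
  fix B assume "B \<in> sets (distr (density fibre_measure g) M r)"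
  then have [measurable]: "B \<in> sets M" by simp
  have "emeasure (distr (density fibre_measure g) M r) B
      = (\<integral>\<^sup>+x. indicator B x \<partial>distr (density fibre_measure g) M r)"
    by simp
  also have "\<dots> = (\<integral>\<^sup>+x. indicator B (r x) \<partial>density fibre_measure g)"
    by (rule nn_integral_distr) measurable
  also have "\<dots> = (\<integral>\<^sup>+x. g x * indicator B (r x) \<partial>fibre_measure)"
    by (rule nn_integral_density) measurable
  also have "\<dots> = (\<integral>\<^sup>+x. fibre_sum (\<lambda>y. g y * indicator B (r y)) x \<partial>M)"
    by (rule nn_integral_fibre_measure) measurable
  \<comment> \<open>On the fibre over \<open>x\<close> the factor \<open>indicator B (r y)\<close>
    is the constant \<open>indicator B x\<close> and leaves the sum.\<close>
  also have "\<dots> = (\<integral>\<^sup>+x. fibre_sum g x * indicator B x \<partial>M)"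
    unfolding fibre_sum_def sum_distrib_right
    by (intro nn_integral_cong sum.cong) (auto simp: mem_fibre)
  also have "\<dots> = emeasure (density M (fibre_sum g)) B"
    by (rule emeasure_density[symmetric]) measurable
  finally show "emeasure (distr (density fibre_measure g) M r) B
      = emeasure (density M (fibre_sum g)) B" .
qed simp

lemma absolutely_continuous_fibre_measure:
  assumes ac: "absolutely_continuous M (distr N M r)" and sets: "sets N = sets M"
  shows "absolutely_continuous fibre_measure N"
  unfolding absolutely_continuous_def
proof
  note [measurable_cong] = sets
  fix B assume "B \<in> null_sets fibre_measure"
  then have [measurable]: "B \<in> sets M" and 0: "emeasure fibre_measure B = 0"
    by auto
  \<comment> \<open>\<open>S\<close> is the image of \<open>B\<close> under \<open>r\<close>.
    Described by a nonzero count of points of \<open>B\<close> in the fibre, it is visibly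
    measurable.\<close>
  define S where "S = {x \<in> space M. fibre_sum (indicator B) x \<noteq> (0::ennreal)}"
  have S [measurable]: "S \<in> sets M"
    unfolding S_def by measurable
  have "AE x in M. fibre_sum (indicator B) x = (0::ennreal)"
    using 0 by (simp add: emeasure_fibre_measure nn_integral_0_iff_AE borel_measurable_fibre_sum)
  then have "S \<in> null_sets M"
    unfolding AE_iff_null_sets[OF S] by eventually_elim (simp add: S_def)
  then have "S \<in> null_sets (distr N M r)"
    using ac by (auto simp: absolutely_continuous_def)
  then have "emeasure N (r -` S \<inter> space N) = 0"
    by (simp add: null_sets_def emeasure_distr)
  moreover have "B \<subseteq> r -` S \<inter> space N"
  proof
    fix y assume "y \<in> B"
    then have y: "y \<in> space M" "y \<in> B"
      using sets.sets_into_space[of B M] by auto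
    then have "y \<in> fibre M r (r y)"
      by (simp add: mem_fibre)
    then show "y \<in> r -` S \<inter> space N"
      using y finite_fibre[OF r_space[OF y(1)]]
      by (auto simp: S_def r_space fibre_sum_def sets_eq_imp_space_eq[OF sets]
          intro!: bexI[of _ y])
  qed
  ultimately show "B \<in> null_sets N"
    using emeasure_mono[of B "r -` S \<inter> space N" N] by (auto simp: null_sets_def)
qed

end

section \<open>The finite measure with density \<open>V\<close>, and integrals against it\<close>

locale weighted_branched_measure = branched_measure M r for M :: "'a measure" and r +
  fixes V :: "'a \<Rightarrow> real"
  assumes V_measurable [measurable]: "V \<in> borel_measurable M"
    and V_nonneg: "x \<in> space M \<Longrightarrow> 0 \<le> V x"
    and V_bounded: "bounded (V ` space M)"
begin

lemma integrable_V: "integrable M V"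
proof -
  from V_bounded obtain C where "\<forall>x\<in>space M. norm (V x) \<le> C"
    by (auto simp: bounded_iff)
  then show ?thesis
    by (intro integrable_const_bound[of _ C] AE_I2) auto
qed

lemma finite_measure_V: "finite_measure (density M V)"
proof
  show "emeasure (density M V) (space (density M V)) \<noteq> \<infinity>"
    using nn_integral_eq_integral[OF integrable_V] V_nonneg
    by (simp add: emeasure_density cong: nn_integral_cong)
qed

lemma L_infinity_integrable: "f \<in> L_infinity M \<Longrightarrow> integrable M f"
  by (auto simp: L_infinity_def intro: integrable_const_bound)

text \<open>Null sets of \<open>M\<close> are null for \<open>density M V\<close>, so an essential
  bound carries over to this finite measure.\<close>

lemma L_infinity_integrable_V:
  assumes "f \<in> L_infinity M"
  shows "integrable (density M V) f"
proof -
  interpret V: finite_measure "density M V"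
    by (rule finite_measure_V)
  from assms obtain C where f: "f \<in> borel_measurable M" and C: "AE x in M. cmod (f x) \<le> C"
    by (auto simp: L_infinity_def)
  have "AE x in density M V. cmod (f x) \<le> C"
    using C by (subst AE_density) (auto elim: eventually_mono)
  then show ?thesis
    using f by (intro V.integrable_const_bound) auto
qed

lemma indicator_L_infinity: "B \<in> sets M \<Longrightarrow> indicator B \<in> L_infinity M"
  by (auto simp: L_infinity_def indicator_def intro!: exI[of _ 1] borel_measurable_indicator)

text \<open>Connects the complex products by which (i) and (ii) are stated with integrals over
  \<open>density M V\<close>.\<close>

lemma complex_density_V:
  assumes "f \<in> borel_measurable M"
  shows "integrable (density M V) f \<longleftrightarrow> integrable M (\<lambda>x. complex_of_real (V x) * f x)"
    and "(\<integral>x. f x \<partial>density M V) = (\<integral>x. complex_of_real (V x) * f x \<partial>M)"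
  using assms V_nonneg
  by (simp_all add: integrable_density integral_density scaleR_conv_of_real AE_I2)

lemma complex_integral_indicator:
  assumes "finite_measure N" "B \<in> sets N"
  shows "(\<integral>x. (indicator B x :: complex) \<partial>N) = complex_of_real (measure N B)"
proof -
  have "(\<integral>x. (indicator B x :: complex) \<partial>N) = (\<integral>x. complex_of_real (indicator B x) \<partial>N)"
    by (intro Bochner_Integration.integral_cong) (auto simp: indicator_def)
  also have "\<dots> = complex_of_real (measure N B)"
    using sets.sets_into_space[OF assms(2)] by (simp add: Int_absorb2)
  finally show ?thesis .
qed

section \<open>(i) and (ii) as identities between measures\<close>

lemma fixed_point_property_iff_distr:
  "fixed_point_property M r V \<longleftrightarrow> distr (density M V) M r = M"
proof
  assume fp: "fixed_point_property M r V"
  interpret V: finite_measure "density M V"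
    by (rule finite_measure_V)
  interpret D: finite_measure "distr (density M V) M r"
    by (rule V.finite_measure_distr) simp
  show "distr (density M V) M r = M"
  proof (rule measure_eqI)
    \<comment> \<open>Testing (i) on the indicator of \<open>B\<close> gives equal real measures; as
      both measures are finite, the \<open>ennreal\<close> values agree too.\<close>
    fix B assume "B \<in> sets (distr (density M V) M r)"
    then have B [measurable]: "B \<in> sets M" by simp
    have "complex_of_real (measure (distr (density M V) M r) B)
        = (\<integral>x. (indicator B x :: complex) \<partial>distr (density M V) M r)"
      by (simp add: complex_integral_indicator D.finite_measure_axioms)
    also have "\<dots> = (\<integral>x. indicator B (r x) \<partial>density M V)"
      by (rule integral_distr) measurable
    also have "\<dots> = (\<integral>x. complex_of_real (V x) * indicator B (r x) \<partial>M)"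
      by (rule complex_density_V) measurable
    also have "\<dots> = (\<integral>x. indicator B x \<partial>M)"
      using fp indicator_L_infinity[OF B] by (auto simp: fixed_point_property_def)
    also have "\<dots> = complex_of_real (measure M B)"
      by (simp add: complex_integral_indicator finite_measure_axioms)
    finally show "emeasure (distr (density M V) M r) B = emeasure M B"
      by (simp add: D.emeasure_eq_measure emeasure_eq_measure)
  qed simp
next
  assume eq: "distr (density M V) M r = M"
  show "fixed_point_property M r V"
    unfolding fixed_point_property_def
  proof
    fix f assume f: "f \<in> L_infinity M"
    then have [measurable]: "f \<in> borel_measurable M"
      by (simp add: L_infinity_def)
    \<comment> \<open>Integrability of \<open>f \<circ> r\<close> is obtained from that of
      \<open>f\<close> under the image measure, without an essential bound for
      \<open>f \<circ> r\<close>.\<close>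
    have "integrable (distr (density M V) M r) f"
      using L_infinity_integrable[OF f] eq by simp
    then have "integrable (density M V) (\<lambda>x. f (r x))"
      by (simp add: integrable_distr_eq)
    moreover have "(\<integral>x. f x \<partial>distr (density M V) M r) = (\<integral>x. f (r x) \<partial>density M V)"
      by (rule integral_distr) measurable
    ultimately show "integrable M (\<lambda>x. complex_of_real (V x) * (f \<circ> r) x) \<and>
        (\<integral>x. complex_of_real (V x) * (f \<circ> r) x \<partial>M) = (\<integral>x. f x \<partial>M)"
      using eq by (simp add: complex_density_V)
  qed
qed

text \<open>An integral over \<open>density fibre_measure \<Delta>\<close> is the integral over
  \<open>M\<close> of a fibre sum weighted by \<open>\<Delta>\<close>. So the identity in (ii)
  compares two measures on test functions, and the indicators among these already determine the
  measures.\<close>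

lemma transition_weight_iff_density:
  "transition_weight M r V \<Delta> \<longleftrightarrow>
     \<Delta> \<in> borel_measurable M \<and> (\<forall>x\<in>space M. 0 \<le> \<Delta> x) \<and>
     (AE x in M. fibre_sum \<Delta> x = 1) \<and> density fibre_measure \<Delta> = density M V"
    (is "_ \<longleftrightarrow> _ \<and> _ \<and> _ \<and> ?D")
proof -
  have "?D \<longleftrightarrow> (\<forall>f\<in>L_infinity M.
        integrable M (fibre_sum (\<lambda>y. complex_of_real (\<Delta> y) * f y)) \<and>
        (\<integral>x. complex_of_real (V x) * f x \<partial>M) =
          (\<integral>x. fibre_sum (\<lambda>y. complex_of_real (\<Delta> y) * f y) x \<partial>M))"
    if \<Delta> [measurable]: "\<Delta> \<in> borel_measurable M" and nonneg: "\<forall>x\<in>space M. 0 \<le> \<Delta> x"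
  proof (intro iffI ballI)
    fix f assume ?D and f: "f \<in> L_infinity M"
    then have [measurable]: "f \<in> borel_measurable M"
      by (simp add: L_infinity_def)
    have nn: "AE x in fibre_measure. 0 \<le> \<Delta> x"
      using nonneg by (intro AE_I2) simp
    have "integrable (density fibre_measure \<Delta>) f"
      using L_infinity_integrable_V[OF f] \<open>?D\<close> by simp
    then have "integrable fibre_measure (\<lambda>y. complex_of_real (\<Delta> y) * f y)"
      using nn by (subst (asm) integrable_density) (auto simp: scaleR_conv_of_real)
    moreover have "(\<integral>x. f x \<partial>density fibre_measure \<Delta>)
        = (\<integral>x. complex_of_real (\<Delta> x) * f x \<partial>fibre_measure)"
      using nn by (subst integral_density) (auto simp: scaleR_conv_of_real)
    ultimately show "integrable M (fibre_sum (\<lambda>y. complex_of_real (\<Delta> y) * f y)) \<and>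
        (\<integral>x. complex_of_real (V x) * f x \<partial>M) =
          (\<integral>x. fibre_sum (\<lambda>y. complex_of_real (\<Delta> y) * f y) x \<partial>M)"
      using integral_fibre_measure[of "\<lambda>y. complex_of_real (\<Delta> y) * f y"] \<open>?D\<close>
      by (simp add: complex_density_V)
  next
    assume tw: "\<forall>f\<in>L_infinity M.
        integrable M (fibre_sum (\<lambda>y. complex_of_real (\<Delta> y) * f y)) \<and>
        (\<integral>x. complex_of_real (V x) * f x \<partial>M) =
          (\<integral>x. fibre_sum (\<lambda>y. complex_of_real (\<Delta> y) * f y) x \<partial>M)"
    interpret V: finite_measure "density M V"
      by (rule finite_measure_V)
    show ?D
    proof (rule measure_eqI)
      fix B assume "B \<in> sets (density fibre_measure \<Delta>)"
      then have B [measurable]: "B \<in> sets M" by simp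
      \<comment> \<open>The hypothesis is an identity of complex numbers, while the measures take
        values in \<open>ennreal\<close>; the real function \<open>h\<close> mediates.\<close>
      define h where "h = fibre_sum (\<lambda>y. \<Delta> y * indicator B y)"
      have h: "fibre_sum (\<lambda>y. complex_of_real (\<Delta> y) * indicator B y)
          = (\<lambda>x. complex_of_real (h x))"
        by (auto simp: h_def fibre_sum_def indicator_def fun_eq_iff intro!: sum.cong)
      have h_nonneg: "0 \<le> h x" for x
        using nonneg by (auto simp: h_def fibre_sum_def mem_fibre intro!: sum_nonneg)
      \<comment> \<open>The integrability clause of (ii) is what later allows the Bochner integral
        of \<open>h\<close> to replace the non-negative one.\<close>
      have int: "integrable M h" and val: "complex_of_real (\<integral>x. h x \<partial>M)
          = (\<integral>x. complex_of_real (V x) * indicator B x \<partial>M)"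
        using bspec[OF tw indicator_L_infinity[OF B]]
        by (simp_all add: h complex_of_real_integrable_eq)
      have "complex_of_real (\<integral>x. h x \<partial>M) = (\<integral>x. (indicator B x :: complex) \<partial>density M V)"
        unfolding val by (rule complex_density_V(2)[symmetric]) measurable
      also have "\<dots> = complex_of_real (measure (density M V) B)"
        by (rule complex_integral_indicator) (simp_all add: V.finite_measure_axioms)
      finally have eq: "(\<integral>x. h x \<partial>M) = measure (density M V) B"
        by (simp only: of_real_eq_iff)
      have "emeasure (density fibre_measure \<Delta>) B
          = (\<integral>\<^sup>+y. ennreal (\<Delta> y) * indicator B y \<partial>fibre_measure)"
        by (rule emeasure_density) simp_all
      also have "\<dots> = (\<integral>\<^sup>+x. fibre_sum (\<lambda>y. ennreal (\<Delta> y) * indicator B y) x \<partial>M)"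
        by (rule nn_integral_fibre_measure) measurable
      also have "\<dots> = (\<integral>\<^sup>+x. ennreal (h x) \<partial>M)"
      proof (rule nn_integral_cong)
        fix x
        have "fibre_sum (\<lambda>y. ennreal (\<Delta> y) * indicator B y) x
            = (\<Sum>y\<in>fibre M r x. ennreal (\<Delta> y * indicator B y))"
          unfolding fibre_sum_def by (rule sum.cong) (auto simp: indicator_def)
        also have "\<dots> = ennreal (h x)"
          unfolding h_def fibre_sum_def using nonneg
          by (intro sum_ennreal) (auto simp: mem_fibre)
        finally show "fibre_sum (\<lambda>y. ennreal (\<Delta> y) * indicator B y) x = ennreal (h x)" .
      qed
      also have "\<dots> = ennreal (\<integral>x. h x \<partial>M)"
        using int h_nonneg by (intro nn_integral_eq_integral) auto
      also have "\<dots> = emeasure (density M V) B"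
        by (simp add: eq V.emeasure_eq_measure)
      finally show "emeasure (density fibre_measure \<Delta>) B = emeasure (density M V) B" .
    qed simp
  qed
  then show ?thesis
    unfolding transition_weight_def fibre_sum_def by blast
qed

text \<open>The image of \<open>density M V\<close> has density \<open>fibre_sum \<Delta>\<close>
  and \<open>M\<close> has density 1, so uniqueness of densities over \<open>M\<close> applies. Both
  directions of the equivalence of (i) and (ii) use this.\<close>

lemma distr_density_V_iff:
  fixes \<Delta> :: "'a \<Rightarrow> real"
  assumes [measurable]: "\<Delta> \<in> borel_measurable M" and nonneg: "\<forall>x\<in>space M. 0 \<le> \<Delta> x"
    and dens: "density fibre_measure \<Delta> = density M V"
  shows "distr (density M V) M r = M \<longleftrightarrow> (AE x in M. fibre_sum \<Delta> x = 1)"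
proof -
  have sum_eq: "fibre_sum (\<lambda>y. ennreal (\<Delta> y)) x = ennreal (fibre_sum \<Delta> x)" for x
    unfolding fibre_sum_def using nonneg by (intro sum_ennreal) (auto simp: mem_fibre)
  have "distr (density M V) M r = density M (fibre_sum (\<lambda>y. ennreal (\<Delta> y)))"
    unfolding dens[symmetric] by (rule distr_density_fibre_measure) measurable
  then have "distr (density M V) M r = M \<longleftrightarrow>
      density M (fibre_sum (\<lambda>y. ennreal (\<Delta> y))) = density M (\<lambda>_. 1)"
    by (simp add: density_1)
  also have "\<dots> \<longleftrightarrow> (AE x in M. fibre_sum (\<lambda>y. ennreal (\<Delta> y)) x = 1)"
    by (rule density_unique_iff) measurable
  also have "\<dots> \<longleftrightarrow> (AE x in M. fibre_sum \<Delta> x = 1)"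
    by (simp add: sum_eq)
  finally show ?thesis .
qed

section \<open>The equivalence of (i) and (ii), and uniqueness\<close>

lemma fixed_point_property_iff:
  "fixed_point_property M r V \<longleftrightarrow> (\<exists>\<Delta>. transition_weight M r V \<Delta>)"
proof
  assume "fixed_point_property M r V"
  then have fp: "distr (density M V) M r = M"
    by (simp add: fixed_point_property_iff_distr)
  interpret L: sigma_finite_measure fibre_measure
    by (rule sigma_finite_fibre_measure)
  have ac: "absolutely_continuous fibre_measure (density M V)"
    by (rule absolutely_continuous_fibre_measure) (simp_all add: fp absolutely_continuous_def)
  \<comment> \<open>Since \<open>density M V\<close> is finite, its Radon-Nikodym derivative has a
    real version that is non-negative everywhere, as \<open>transition_weight\<close>
    demands.\<close>
  obtain \<Delta> where \<Delta>: "\<Delta> \<in> borel_measurable fibre_measure"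
    "AE x in fibre_measure. RN_deriv fibre_measure (density M V) x = ennreal (\<Delta> x)"
    "\<And>x. 0 \<le> \<Delta> x"
    using L.real_RN_deriv[OF finite_measure_V ac] by auto
  have meas: "\<Delta> \<in> borel_measurable M"
    using \<Delta>(1) by simp
  have "density fibre_measure \<Delta> = density fibre_measure (RN_deriv fibre_measure (density M V))"
    using \<Delta> by (intro density_cong) auto
  also have "\<dots> = density M V"
    using ac by (intro L.density_RN_deriv) simp_all
  finally have dens: "density fibre_measure \<Delta> = density M V" .
  show "\<exists>\<Delta>. transition_weight M r V \<Delta>"
    using distr_density_V_iff[OF meas _ dens] meas dens \<Delta>(3) fp
    by (auto simp: transition_weight_iff_density)
next
  assume "\<exists>\<Delta>. transition_weight M r V \<Delta>"
  then show "fixed_point_property M r V"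
    using distr_density_V_iff
    by (auto simp: transition_weight_iff_density fixed_point_property_iff_distr)
qed

lemma transition_weight_unique:
  assumes "transition_weight M r V \<Delta>" "transition_weight M r V \<Delta>'"
  shows "AE x in density M (\<lambda>x. ennreal (V x)). \<Delta> x = \<Delta>' x"
proof -
  have [measurable]: "\<Delta> \<in> borel_measurable M" "\<Delta>' \<in> borel_measurable M"
    and nonneg: "\<forall>x\<in>space M. 0 \<le> \<Delta> x" "\<forall>x\<in>space M. 0 \<le> \<Delta>' x"
    and dens: "density fibre_measure \<Delta> = density M V" "density fibre_measure \<Delta>' = density M V"
    using assms by (simp_all add: transition_weight_iff_density)
  interpret L: sigma_finite_measure fibre_measure
    by (rule sigma_finite_fibre_measure)
  have "AE x in fibre_measure. ennreal (\<Delta> x) = ennreal (\<Delta>' x)"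
    using dens by (subst L.density_unique_iff[symmetric]) simp_all
  \<comment> \<open>\<open>ennreal\<close> is injective only on non-negative reals, and
    non-negativity is known on \<open>space M\<close>; hence \<open>AE_space\<close>.\<close>
  then have "AE x in fibre_measure. \<Delta> x = \<Delta>' x"
    using AE_space by eventually_elim (use nonneg in simp)
  \<comment> \<open>Passing to a density keeps null sets null, and this density is
    \<open>density M V\<close>.\<close>
  then have "AE x in density fibre_measure \<Delta>. \<Delta> x = \<Delta>' x"
    by (subst AE_density) (auto elim: eventually_mono)
  then show ?thesis
    unfolding dens(1) .
qed

end

theorem theorem5p8p9:
  fixes M :: "'a measure" and r :: "'a \<Rightarrow> 'a" and V :: "'a \<Rightarrow> real"
  assumes "finite_measure M"
    and "space M \<noteq> {}"
    and "branched_endomorphism M r"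
    and "V \<in> borel_measurable M"
    and "\<forall>x\<in>space M. 0 \<le> V x"
    and "bounded (V ` space M)"
  shows "(fixed_point_property M r V \<longleftrightarrow> (\<exists>\<Delta>. transition_weight M r V \<Delta>)) \<and>
    (\<forall>\<Delta> \<Delta>'. transition_weight M r V \<Delta> \<longrightarrow> transition_weight M r V \<Delta>' \<longrightarrow>
       (AE x in density M (\<lambda>x. ennreal (V x)). \<Delta> x = \<Delta>' x))"
proof -
  interpret weighted_branched_measure M r V
    using assms
    by (simp add: weighted_branched_measure_def branched_measure_def branched_measure_axioms_def
        weighted_branched_measure_axioms_def)
  show ?thesis
    using fixed_point_property_iff transition_weight_unique by blast
qed

end
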